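(* Let $c, c_1,\dots,c_n>0$. Suppose that a rectangle of ratio $c$ can be tiled by finitely many rectangles each of which has ratio equal to one of $c_1,\dots,c_n$. Then $c=C(c_1,\dots,c_n)$ for some rational function $C(z_1,\dots,z_n)$ such that: (1) $C$ has rational coefficients, i.e. $C\in\mathbb{Q}(z_1,\dots,z_n)$; (2) $C$ is homogeneous of degree $1$, i.e. $C(tz_1,\dots,tz_n)=tC(z_1,\dots,z_n)$; (3) if $z_1,\dots,z_n\in\mathbb{C}$ satisfy $\operatorname{Re}z_1,\dots,\operatorname{Re}z_n>0$, then $\operatorname{Re}C(z_1,\dots,z_n)>0$.
   Context: All rectangles (the tiled one and the tiles) have sides parallel to the coordinate axes and are nondegenerate; a tiling is a finite decomposition into such rectangles with disjoint interiors. The ratio of a rectangle is the length of its horizontal side divided by the length of its vertical side. *)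

theory Defs
  imports
    "HOL-Analysis.Analysis"
    "HOL-Library.Poly_Mapping"
    "HOL-Computational_Algebra.Fraction_Field"
begin

definition rectangle_of_ratio :: "real \<Rightarrow> (real \<times> real) set \<Rightarrow> bool" where
  "rectangle_of_ratio r R \<longleftrightarrow>
     (\<exists>x1 x2 y1 y2. x1 < x2 \<and> y1 < y2 \<and> R = {x1..x2} \<times> {y1..y2} \<and> r = (x2 - x1) / (y2 - y1))"

text \<open>
  Polynomials over the rationals in variables indexed by the natural numbers, as finitely supported
  maps from exponent vectors to coefficients, and their field of fractions.
\<close>

type_synonym rat_mpoly = "(nat \<Rightarrow>\<^sub>0 nat) \<Rightarrow>\<^sub>0 rat"

instance poly_mapping :: (linorder, "{ordered_comm_monoid_add, ordered_ab_semigroup_add_imp_le,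
  cancel_comm_monoid_add, linorder}") ordered_cancel_comm_monoid_add ..

type_synonym rat_fun = "rat_mpoly fract"

definition mpoly_in :: "nat set \<Rightarrow> rat_mpoly set" where
  "mpoly_in V = {p. \<forall>m \<in> Poly_Mapping.keys p. Poly_Mapping.keys m \<subseteq> V}"

definition rat_fun_in :: "nat set \<Rightarrow> rat_fun set" where
  "rat_fun_in V = {Fract p q | p q. p \<in> mpoly_in V \<and> q \<in> mpoly_in V \<and> q \<noteq> 0}"

definition mpoly_eval :: "rat_mpoly \<Rightarrow> (nat \<Rightarrow> 'a::field_char_0) \<Rightarrow> 'a" where
  "mpoly_eval p z = (\<Sum>m \<in> Poly_Mapping.keys p. of_rat (Poly_Mapping.lookup p m) *
      (\<Prod>i \<in> Poly_Mapping.keys m. z i ^ Poly_Mapping.lookup m i))"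

definition rat_fun_defined_at :: "rat_fun \<Rightarrow> (nat \<Rightarrow> 'a::field_char_0) \<Rightarrow> bool" where
  "rat_fun_defined_at C z \<longleftrightarrow> (\<exists>p q. C = Fract p q \<and> mpoly_eval q z \<noteq> 0)"

text \<open>
  The value does not depend on the chosen representation, see \<open>rat_fun_eval_Fract\<close> below; it is
  meaningful only at points where the rational function is defined.
\<close>

definition rat_fun_eval :: "rat_fun \<Rightarrow> (nat \<Rightarrow> 'a::field_char_0) \<Rightarrow> 'a" where
  "rat_fun_eval C z =
     (THE v. \<exists>p q. C = Fract p q \<and> mpoly_eval q z \<noteq> 0 \<and> v = mpoly_eval p z / mpoly_eval q z)"

lemma mpoly_eval_superset:
  assumes "finite A" "Poly_Mapping.keys p \<subseteq> A"
  shows "mpoly_eval p z = (\<Sum>m \<in> A. of_rat (Poly_Mapping.lookup p m) *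
      (\<Prod>i \<in> Poly_Mapping.keys m. z i ^ Poly_Mapping.lookup m i))"
  unfolding mpoly_eval_def
  by (rule sum.mono_neutral_left) (use assms in \<open>auto simp: in_keys_iff\<close>)

lemma mpoly_eval_0 [simp]: "mpoly_eval 0 z = 0"
  by (simp add: mpoly_eval_def)

lemma mpoly_eval_add: "mpoly_eval (p + q) z = mpoly_eval p z + mpoly_eval q z"
proof -
  let ?A = "Poly_Mapping.keys p \<union> Poly_Mapping.keys q"
  have "finite ?A" "Poly_Mapping.keys (p + q) \<subseteq> ?A"
    using keys_add[of p q] by auto
  then show ?thesis
    by (simp add: mpoly_eval_superset[of ?A] lookup_add of_rat_add distrib_right sum.distrib)
qed

lemma monom_eval_add:
  fixes z :: "nat \<Rightarrow> 'a::field_char_0" and k l :: "nat \<Rightarrow>\<^sub>0 nat"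
  shows "(\<Prod>i \<in> Poly_Mapping.keys (k + l). z i ^ Poly_Mapping.lookup (k + l) i) =
    (\<Prod>i \<in> Poly_Mapping.keys k. z i ^ Poly_Mapping.lookup k i) *
    (\<Prod>i \<in> Poly_Mapping.keys l. z i ^ Poly_Mapping.lookup l i)"
proof -
  let ?A = "Poly_Mapping.keys k \<union> Poly_Mapping.keys l"
  have *: "(\<Prod>i \<in> Poly_Mapping.keys m. z i ^ Poly_Mapping.lookup m i) =
      (\<Prod>i \<in> ?A. z i ^ Poly_Mapping.lookup m i)" if "Poly_Mapping.keys m \<subseteq> ?A" for m
    by (rule prod.mono_neutral_left) (use that in \<open>auto simp: in_keys_iff\<close>)
  show ?thesis
    unfolding *[OF keys_add] *[OF Un_upper1] *[OF Un_upper2]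
    by (simp add: lookup_add power_add prod.distrib)
qed

lemma mpoly_eval_single:
  "mpoly_eval (Poly_Mapping.single m a) z =
     of_rat a * (\<Prod>i \<in> Poly_Mapping.keys m. z i ^ Poly_Mapping.lookup m i)"
  by (simp add: mpoly_eval_def)

lemma update_eq_add_single:
  fixes f :: "'a \<Rightarrow>\<^sub>0 'b::comm_monoid_add"
  assumes "a \<notin> Poly_Mapping.keys f"
  shows "Poly_Mapping.update a b f = f + Poly_Mapping.single a b"
  by (rule poly_mapping_eqI)
    (use assms in \<open>auto simp: update.rep_eq lookup_add lookup_single when_def in_keys_iff\<close>)

lemma mpoly_eval_mult: "mpoly_eval (p * q) z = mpoly_eval p z * mpoly_eval q z"
proof (induction p rule: update_induct)
  case (update p k a)
  have "mpoly_eval (Poly_Mapping.single k a * q) z =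
      mpoly_eval (Poly_Mapping.single k a) z * mpoly_eval q z"
  proof (induction q rule: update_induct)
    case (update q l b)
    then show ?case
      by (simp add: update_eq_add_single distrib_left mpoly_eval_add mult_single
          mpoly_eval_single monom_eval_add of_rat_mult mult_ac)
  qed simp
  with update show ?case
    by (simp add: update_eq_add_single distrib_right mpoly_eval_add)
qed simp

lemma rat_fun_eval_Fract:
  assumes "mpoly_eval q z \<noteq> 0"
  shows "rat_fun_eval (Fract p q) z = mpoly_eval p z / mpoly_eval q z"
  unfolding rat_fun_eval_def
proof (rule the_equality)
  fix v
  assume "\<exists>p' q'. Fract p q = Fract p' q' \<and> mpoly_eval q' z \<noteq> 0 \<and>
    v = mpoly_eval p' z / mpoly_eval q' z"
  then obtain p' q' where *: "Fract p q = Fract p' q'" "mpoly_eval q' z \<noteq> 0"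
    and v: "v = mpoly_eval p' z / mpoly_eval q' z"
    by blast
  have "q \<noteq> 0" "q' \<noteq> 0"
    using assms *(2) by auto
  then have "p * q' = p' * q"
    using *(1) by (simp add: eq_fract)
  then have "mpoly_eval p z * mpoly_eval q' z = mpoly_eval p' z * mpoly_eval q z"
    by (simp flip: mpoly_eval_mult)
  then show "v = mpoly_eval p z / mpoly_eval q z"
    using assms *(2) v by (simp add: frac_eq_eq)
qed (use assms in blast)

end

theory Submission
  imports Defs
begin

text \<open>
  Regard the tiling as an electrical network: the nodes are the heights at which tiles end, with the
  bottom of the big rectangle grounded, and every tile is an edge from its lower to its upper height
  whose conductance is its ratio. Heights are potentials and widths are currents; Kirchhoff's law
  holds because every horizontal line meets tiles of total width equal to that of the big rectangle.
  (All horizontal segments at one height may be merged into one node, so no planarity is involved.)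
  The number \<open>c\<close> is thus the conductance between top and bottom. For variable conductances
  \<open>z\<close> of positive real part the Laplacian \<open>A(z)\<close> satisfies
  \<open>Re \<langle>u, A(z) u\<rangle> > 0\<close> for \<open>u \<noteq> 0\<close>. Eliminating a node replaces \<open>A\<close> by a Schur
  complement, which preserves this inequality as well as the property that the entries are rational
  and homogeneous of degree 1. The single entry remaining at the end is \<open>C(z)\<close>.
\<close>

section \<open>Values and variables of rational polynomials\<close>

definition right_half :: "nat set \<Rightarrow> (nat \<Rightarrow> complex) set" where
  "right_half V = {z. \<forall>i\<in>V. Re (z i) > 0}"

lemma one_in_right_half: "(\<lambda>_. 1) \<in> right_half V"
  by (simp add: right_half_def)

lemma mpoly_eval_diff: "mpoly_eval (p - q) z = mpoly_eval p z - mpoly_eval q z"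
  using mpoly_eval_add[of "p - q" q z] by simp

lemma mpoly_eval_1 [simp]: "mpoly_eval 1 z = 1"
  by (simp add: mpoly_eval_def)

lemma mpoly_eval_sum: "mpoly_eval (\<Sum>j\<in>J. p j) z = (\<Sum>j\<in>J. mpoly_eval (p j) z)"
  by (induction J rule: infinite_finite_induct) (auto simp: mpoly_eval_add)

lemma of_real_of_rat: "of_real (of_rat x) = (of_rat x :: complex)"
  by (cases x) (simp add: of_rat_rat)

lemma mpoly_eval_of_real:
  "mpoly_eval p (\<lambda>i. complex_of_real (x i)) = of_real (mpoly_eval p x)"
  by (simp add: mpoly_eval_def of_real_of_rat)

text \<open>Restricting to a complex line turns identities in several variables into univariate
  ones, which extend from infinitely many points because a nonzero polynomial has finitely many
  roots.\<close>

lemma mpoly_eval_on_line: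
  "\<exists>P :: complex poly. \<forall>s. mpoly_eval p (\<lambda>i. a i + s * b i) = poly P s"
proof -
  let ?P = "\<Sum>m \<in> Poly_Mapping.keys p. smult (of_rat (Poly_Mapping.lookup p m))
      (\<Prod>i \<in> Poly_Mapping.keys m. [:a i, b i:] ^ Poly_Mapping.lookup m i)"
  have "\<forall>s. mpoly_eval p (\<lambda>i. a i + s * b i) = poly ?P s"
    by (simp add: mpoly_eval_def poly_sum poly_prod)
  then show ?thesis by blast
qed

lemma mpoly_in_diff: "p \<in> mpoly_in V \<Longrightarrow> q \<in> mpoly_in V \<Longrightarrow> p - q \<in> mpoly_in V"
  using keys_diff[of p q] by (auto simp: mpoly_in_def)

lemma mpoly_in_mult: "p \<in> mpoly_in V \<Longrightarrow> q \<in> mpoly_in V \<Longrightarrow> p * q \<in> mpoly_in V"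
  unfolding mpoly_in_def
proof (intro CollectI ballI)
  fix m assume *: "p \<in> {p. \<forall>m\<in>Poly_Mapping.keys p. Poly_Mapping.keys m \<subseteq> V}"
    "q \<in> {p. \<forall>m\<in>Poly_Mapping.keys p. Poly_Mapping.keys m \<subseteq> V}"
    and "m \<in> Poly_Mapping.keys (p * q)"
  then obtain a b where "m = a + b" "a \<in> Poly_Mapping.keys p" "b \<in> Poly_Mapping.keys q"
    using keys_mult[of p q] by blast
  then show "Poly_Mapping.keys m \<subseteq> V"
    using * keys_add[of a b] by blast
qed

lemma mpoly_in_1: "1 \<in> mpoly_in V"
  by (simp add: mpoly_in_def)

lemma mpoly_in_sum: "(\<And>j. j \<in> J \<Longrightarrow> p j \<in> mpoly_in V) \<Longrightarrow> (\<Sum>j\<in>J. p j) \<in> mpoly_in V"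
proof (induction J rule: infinite_finite_induct)
  case (insert j J)
  then show ?case
    using keys_add[of "p j" "\<Sum>j\<in>J. p j"] by (auto simp: mpoly_in_def)
qed (auto simp: mpoly_in_def)

section \<open>Homogeneous rational functions of degree 1\<close>

text \<open>Stated through complex values instead of degrees of monomials: products and differences
  are then immediate, and \<open>0\<close> is homogeneous of every degree, so cancellation in a
  difference does no harm.\<close>

definition homogeneous :: "nat \<Rightarrow> rat_mpoly \<Rightarrow> bool" where
  "homogeneous k p \<longleftrightarrow>
     (\<forall>(t::complex) z. mpoly_eval p (\<lambda>i. t * z i) = t ^ k * mpoly_eval p z)"

lemma homogeneous_diff: "homogeneous k p \<Longrightarrow> homogeneous k q \<Longrightarrow> homogeneous k (p - q)"
  by (simp add: homogeneous_def mpoly_eval_diff algebra_simps)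

lemma homogeneous_mult: "homogeneous k p \<Longrightarrow> homogeneous l q \<Longrightarrow> homogeneous (k + l) (p * q)"
  by (simp add: homogeneous_def mpoly_eval_mult power_add algebra_simps)

lemma homogeneous_1: "homogeneous 0 1"
  by (simp add: homogeneous_def)

text \<open>One pair \<open>p\<close>, \<open>q\<close> must serve the whole right half-space.
  Keeping \<open>f\<close> a function lets elimination divide pointwise; \<open>k\<close> is left
  open because the denominators built during elimination grow in degree.\<close>

definition homogeneous_ratio :: "nat set \<Rightarrow> ((nat \<Rightarrow> complex) \<Rightarrow> complex) \<Rightarrow> bool" where
  "homogeneous_ratio V f \<longleftrightarrow>
     (\<exists>p q k. p \<in> mpoly_in V \<and> q \<in> mpoly_in V \<and> homogeneous (Suc k) p \<and> homogeneous k q \<and>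
       (\<forall>z\<in>right_half V. mpoly_eval q z \<noteq> 0 \<and> f z = mpoly_eval p z / mpoly_eval q z))"

text \<open>The entries of the Laplacian have this form. Since \<open>idx\<close> need not be
  injective (tiles may share a variable), \<open>p\<close> is a sum of monomials in which equal
  variables merge by themselves.\<close>

lemma homogeneous_ratio_linear:
  assumes "\<And>j. j \<in> J \<Longrightarrow> idx j \<in> V"
  shows "homogeneous_ratio V (\<lambda>z. \<Sum>j\<in>J. of_int (m j) * z (idx j))"
proof -
  define p :: rat_mpoly where
    "p = (\<Sum>j\<in>J. Poly_Mapping.single (Poly_Mapping.single (idx j) 1) (of_int (m j)))"
  have ev: "mpoly_eval p z = (\<Sum>j\<in>J. of_int (m j) * z (idx j))" for z :: "nat \<Rightarrow> complex"
    by (simp add: p_def mpoly_eval_sum mpoly_eval_single)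
  have "homogeneous (Suc 0) p"
    by (simp add: homogeneous_def ev sum_distrib_left mult_ac)
  moreover have "p \<in> mpoly_in V"
    unfolding p_def by (rule mpoly_in_sum) (use assms in \<open>auto simp: mpoly_in_def\<close>)
  ultimately show ?thesis
    unfolding homogeneous_ratio_def
    by (intro exI[of _ p] exI[of _ 1] exI[of _ 0]) (simp add: homogeneous_1 mpoly_in_1 ev)
qed

text \<open>Bring everything over the denominator \<open>q1 * q2 * q3 * p4\<close>. Dividing by
  \<open>d\<close> moves \<open>p4\<close> there; it has no zero in the right half-space because
  \<open>d\<close> has none, and its degree \<open>Suc k4\<close> is the source of the
  \<open>Suc\<close> in \<open>k\<close>.\<close>

lemma homogeneous_ratio_schur:
  assumes "homogeneous_ratio V f" "homogeneous_ratio V g" "homogeneous_ratio V h"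
    and "homogeneous_ratio V d" and nz: "\<And>z. z \<in> right_half V \<Longrightarrow> d z \<noteq> 0"
  shows "homogeneous_ratio V (\<lambda>z. f z - g z * h z / d z)"
proof -
  obtain p1 q1 k1 where 1: "p1 \<in> mpoly_in V" "q1 \<in> mpoly_in V"
    "homogeneous (Suc k1) p1" "homogeneous k1 q1"
    "\<And>z. z \<in> right_half V \<Longrightarrow> mpoly_eval q1 z \<noteq> 0 \<and> f z = mpoly_eval p1 z / mpoly_eval q1 z"
    using assms(1) unfolding homogeneous_ratio_def by blast
  obtain p2 q2 k2 where 2: "p2 \<in> mpoly_in V" "q2 \<in> mpoly_in V"
    "homogeneous (Suc k2) p2" "homogeneous k2 q2"
    "\<And>z. z \<in> right_half V \<Longrightarrow> mpoly_eval q2 z \<noteq> 0 \<and> g z = mpoly_eval p2 z / mpoly_eval q2 z"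
    using assms(2) unfolding homogeneous_ratio_def by blast
  obtain p3 q3 k3 where 3: "p3 \<in> mpoly_in V" "q3 \<in> mpoly_in V"
    "homogeneous (Suc k3) p3" "homogeneous k3 q3"
    "\<And>z. z \<in> right_half V \<Longrightarrow> mpoly_eval q3 z \<noteq> 0 \<and> h z = mpoly_eval p3 z / mpoly_eval q3 z"
    using assms(3) unfolding homogeneous_ratio_def by blast
  obtain p4 q4 k4 where 4: "p4 \<in> mpoly_in V" "q4 \<in> mpoly_in V"
    "homogeneous (Suc k4) p4" "homogeneous k4 q4"
    "\<And>z. z \<in> right_half V \<Longrightarrow> mpoly_eval q4 z \<noteq> 0 \<and> d z = mpoly_eval p4 z / mpoly_eval q4 z"
    using assms(4) unfolding homogeneous_ratio_def by blast
  define k where "k = k1 + (k2 + (k3 + Suc k4))"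
  let ?p = "p1 * (q2 * (q3 * p4)) - p2 * (p3 * (q4 * q1))"
  let ?q = "q1 * (q2 * (q3 * p4))"
  have "homogeneous (Suc k1 + (k2 + (k3 + Suc k4))) (p1 * (q2 * (q3 * p4)))"
    "homogeneous (Suc k2 + (Suc k3 + (k4 + k1))) (p2 * (p3 * (q4 * q1)))"
    "homogeneous k ?q"
    unfolding k_def by (intro homogeneous_mult 1 2 3 4)+
  moreover have "Suc k1 + (k2 + (k3 + Suc k4)) = Suc k" "Suc k2 + (Suc k3 + (k4 + k1)) = Suc k"
    by (simp_all add: k_def)
  ultimately have "homogeneous (Suc k) ?p" "homogeneous k ?q"
    by (simp_all only: homogeneous_diff)
  moreover have "?p \<in> mpoly_in V" "?q \<in> mpoly_in V"
    by (intro mpoly_in_diff mpoly_in_mult 1 2 3 4)+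
  moreover have "mpoly_eval ?q z \<noteq> 0 \<and> f z - g z * h z / d z = mpoly_eval ?p z / mpoly_eval ?q z"
    if "z \<in> right_half V" for z
  proof -
    note nonzero = 1(5)[OF that] 2(5)[OF that] 3(5)[OF that] 4(5)[OF that] nz[OF that]
    have "mpoly_eval p1 z = f z * mpoly_eval q1 z" "mpoly_eval p2 z = g z * mpoly_eval q2 z"
      "mpoly_eval p3 z = h z * mpoly_eval q3 z" "mpoly_eval p4 z = d z * mpoly_eval q4 z"
      using nonzero by simp_all
    moreover have "mpoly_eval q1 z \<noteq> 0" "mpoly_eval q2 z \<noteq> 0" "mpoly_eval q3 z \<noteq> 0"
      "mpoly_eval q4 z \<noteq> 0" "d z \<noteq> 0"
      using nonzero by blast+
    ultimately show ?thesis
      by (simp add: mpoly_eval_mult mpoly_eval_diff diff_divide_distrib mult_ac)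
  qed
  ultimately show ?thesis
    unfolding homogeneous_ratio_def by blast
qed

text \<open>
  At a point where \<open>q\<close> vanishes, the value is computed from other representations, possibly
  different ones at \<open>z\<close> and at \<open>t z\<close>; the identity is extended to such points along the line
  \<open>z + s (1, \<dots>, 1)\<close>, which enters the right half space for large \<open>s\<close>.
\<close>

lemma rat_fun_eval_scale:
  fixes z :: "nat \<Rightarrow> complex"
  assumes hom: "homogeneous (Suc k) p" "homogeneous k q"
    and nz: "\<And>z. z \<in> right_half V \<Longrightarrow> mpoly_eval q z \<noteq> 0"
    and dz: "rat_fun_defined_at (Fract p q) z"
    and dtz: "rat_fun_defined_at (Fract p q) (\<lambda>i. t * z i)" and "finite V"
  shows "rat_fun_eval (Fract p q) (\<lambda>i. t * z i) = t * rat_fun_eval (Fract p q) z"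
proof -
  obtain p1 q1 where 1: "Fract p q = Fract p1 q1" "mpoly_eval q1 z \<noteq> 0"
    using dz unfolding rat_fun_defined_at_def by blast
  obtain p2 q2 where 2: "Fract p q = Fract p2 q2" "mpoly_eval q2 (\<lambda>i. t * z i) \<noteq> 0"
    using dtz unfolding rat_fun_defined_at_def by blast
  have "q \<noteq> 0" "q1 \<noteq> 0" "q2 \<noteq> 0"
    using nz[OF one_in_right_half] 1(2) 2(2) by auto
  then have eqs: "p * q1 = p1 * q" "p * q2 = p2 * q"
    using 1(1)[unfolded eq_fract(1)[OF \<open>q \<noteq> 0\<close> \<open>q1 \<noteq> 0\<close>]]
      2(1)[unfolded eq_fract(1)[OF \<open>q \<noteq> 0\<close> \<open>q2 \<noteq> 0\<close>]] by auto
  have ev: "mpoly_eval p w * mpoly_eval q1 w = mpoly_eval p1 w * mpoly_eval q w"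
    "mpoly_eval p w * mpoly_eval q2 w = mpoly_eval p2 w * mpoly_eval q w" for w :: "nat \<Rightarrow> complex"
    using eqs by (simp_all flip: mpoly_eval_mult)
  \<comment> \<open>For \<open>s\<close> nonzero, homogeneity gives this after cancelling
    \<open>s ^ k\<close>. Both sides are polynomials in \<open>s\<close>, so it persists at
    \<open>s = 0\<close>; thus \<open>t = 0\<close> needs no separate treatment.\<close>
  have scaled: "s * mpoly_eval p w * mpoly_eval q2 (\<lambda>i. s * w i) =
      mpoly_eval p2 (\<lambda>i. s * w i) * mpoly_eval q w" for s and w :: "nat \<Rightarrow> complex"
  proof -
    obtain P where P: "\<And>s. mpoly_eval p2 (\<lambda>i. s * w i) = poly P s"
      using mpoly_eval_on_line[of p2 "\<lambda>_. 0" w] by auto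
    obtain Q where Q: "\<And>s. mpoly_eval q2 (\<lambda>i. s * w i) = poly Q s"
      using mpoly_eval_on_line[of q2 "\<lambda>_. 0" w] by auto
    let ?F = "smult (mpoly_eval p w) ([:0, 1:] * Q) - smult (mpoly_eval q w) P"
    have "poly ?F s = 0" if "s \<noteq> 0" for s
      using ev(2)[of "\<lambda>i. s * w i"] hom that by (simp add: homogeneous_def P Q mult_ac)
    then have "-{0} \<subseteq> {s. poly ?F s = 0}"
      by auto
    moreover have "infinite (-{0::complex})"
      by (simp add: infinite_UNIV_char_0 Compl_eq_Diff_UNIV)
    ultimately have "?F = 0"
      using poly_roots_finite[of ?F] infinite_super by blast
    then have "poly ?F s = 0"
      by simp
    then show ?thesis
      by (simp add: P Q mult_ac)
  qed
  \<comment> \<open>A real shift \<open>s > M\<close> makes every \<open>Re (z i) + s\<close> with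
    \<open>i\<close> in \<open>V\<close> positive.\<close>
  define M where "M = (\<Sum>i\<in>V. \<bar>Re (z i)\<bar>)"
  \<comment> \<open>The claim with denominators cleared. In the right half-space the common factor
    \<open>mpoly_eval q w\<close> can be cancelled; the resulting identity no longer mentions
    \<open>q\<close>.\<close>
  have on_half: "mpoly_eval p2 (\<lambda>i. t * w i) * mpoly_eval q1 w =
      t * mpoly_eval p1 w * mpoly_eval q2 (\<lambda>i. t * w i)" if "w \<in> right_half V" for w
  proof -
    have "mpoly_eval q w * (mpoly_eval p2 (\<lambda>i. t * w i) * mpoly_eval q1 w) =
      t * mpoly_eval q2 (\<lambda>i. t * w i) * (mpoly_eval p w * mpoly_eval q1 w)"
      using scaled[of t w] by (simp add: mult_ac)
    also have "\<dots> = mpoly_eval q w * (t * mpoly_eval p1 w * mpoly_eval q2 (\<lambda>i. t * w i))"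
      by (simp add: ev(1) mult_ac)
    finally show ?thesis
      using nz[OF that] by simp
  qed
  obtain P1 where P1: "\<And>s. mpoly_eval p1 (\<lambda>i. z i + s) = poly P1 s"
    using mpoly_eval_on_line[of p1 z "\<lambda>_. 1"] by auto
  obtain Q1 where Q1: "\<And>s. mpoly_eval q1 (\<lambda>i. z i + s) = poly Q1 s"
    using mpoly_eval_on_line[of q1 z "\<lambda>_. 1"] by auto
  obtain P2 where P2: "\<And>s. mpoly_eval p2 (\<lambda>i. t * (z i + s)) = poly P2 s"
    using mpoly_eval_on_line[of p2 "\<lambda>i. t * z i" "\<lambda>_. t"] by (auto simp: algebra_simps)
  obtain Q2 where Q2: "\<And>s. mpoly_eval q2 (\<lambda>i. t * (z i + s)) = poly Q2 s"
    using mpoly_eval_on_line[of q2 "\<lambda>i. t * z i" "\<lambda>_. t"] by (auto simp: algebra_simps)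
  let ?F = "P2 * Q1 - smult t (P1 * Q2)"
  have "poly ?F (of_real s) = 0" if "s > M" for s
  proof -
    have "Re (z i) + s > 0" if "i \<in> V" for i
      using member_le_sum[of i V "\<lambda>i. \<bar>Re (z i)\<bar>"] that \<open>finite V\<close> \<open>s > M\<close>
      by (auto simp: M_def)
    then have "(\<lambda>i. z i + of_real s) \<in> right_half V"
      by (simp add: right_half_def)
    from on_half[OF this] show ?thesis
      by (simp add: P1 P2 Q1 Q2 mult_ac)
  qed
  then have "complex_of_real ` {M<..} \<subseteq> {s. poly ?F s = 0}"
    by auto
  moreover have "infinite (complex_of_real ` {M<..})"
    by (subst finite_image_iff) (auto simp: inj_on_def infinite_Ioi)
  ultimately have "?F = 0"
    using poly_roots_finite[of ?F] infinite_super by blast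
  then have "poly ?F 0 = 0"
    by simp
  then have "mpoly_eval p2 (\<lambda>i. t * z i) * mpoly_eval q1 z =
      t * mpoly_eval p1 z * mpoly_eval q2 (\<lambda>i. t * z i)"
    using P1[of 0] Q1[of 0] P2[of 0] Q2[of 0] by (simp add: mult_ac)
  then have "mpoly_eval p2 (\<lambda>i. t * z i) / mpoly_eval q2 (\<lambda>i. t * z i) =
      t * (mpoly_eval p1 z / mpoly_eval q1 z)"
    using 1(2) 2(2) by (simp add: frac_eq_eq mult_ac)
  moreover have "rat_fun_eval (Fract p q) z = mpoly_eval p1 z / mpoly_eval q1 z"
    by (subst 1(1)) (rule rat_fun_eval_Fract[OF 1(2)])
  moreover have "rat_fun_eval (Fract p q) (\<lambda>i. t * z i) =
      mpoly_eval p2 (\<lambda>i. t * z i) / mpoly_eval q2 (\<lambda>i. t * z i)"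
    by (subst 2(1)) (rule rat_fun_eval_Fract[OF 2(2)])
  ultimately show ?thesis
    by (simp only:)
qed

section \<open>Elimination of nodes by Schur complements\<close>

text \<open>Induction on the nodes to eliminate. If row \<open>k\<close> vanishes on
  \<open>u\<close>, it determines \<open>u k\<close>, and substitution turns the other rows into
  those of the Schur complement. The form of the complement at \<open>u\<close> is the form of
  \<open>A\<close> at the extension of \<open>u\<close> by that value, so positivity survives.
  Existence of a solution \<open>u\<close> is not claimed.\<close>

lemma schur_elimination:
  fixes A :: "'a \<Rightarrow> 'a \<Rightarrow> (nat \<Rightarrow> complex) \<Rightarrow> complex"
  assumes "finite N" "r \<notin> N"
    and "\<And>a b. a \<in> insert r N \<Longrightarrow> b \<in> insert r N \<Longrightarrow> homogeneous_ratio V (A a b)"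
    and "\<And>z u a. z \<in> right_half V \<Longrightarrow> a \<in> insert r N \<Longrightarrow> u a \<noteq> 0 \<Longrightarrow>
      Re (\<Sum>a\<in>insert r N. cnj (u a) * (\<Sum>b\<in>insert r N. A a b z * u b)) > 0"
  shows "\<exists>C. homogeneous_ratio V C \<and> (\<forall>z\<in>right_half V. Re (C z) > 0 \<and>
    (\<forall>u. (\<forall>a\<in>N. (\<Sum>b\<in>insert r N. A a b z * u b) = 0) \<longrightarrow>
      (\<Sum>b\<in>insert r N. A r b z * u b) = C z * u r))"
  using assms
proof (induction N arbitrary: A rule: finite_induct)
  case empty
  have "Re (A r r z) > 0" if "z \<in> right_half V" for z
    using empty(3)[OF that, of r "\<lambda>_. 1"] by simp
  then show ?case
    using empty(2) by (intro exI[of _ "A r r"]) simp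
next
  case (insert k N)
  let ?M = "insert r N"
  have fin: "finite ?M" and k: "k \<notin> ?M" and ins: "insert r (insert k N) = insert k ?M"
    using insert.hyps insert.prems(1) by auto
  note hr = insert.prems(2)[unfolded ins] and pos = insert.prems(3)[unfolded ins]
  \<comment> \<open>On the unit vector at \<open>k\<close> the form takes the value
    \<open>A k k z\<close>, whose real part is therefore positive.\<close>
  have nz: "A k k z \<noteq> 0" if "z \<in> right_half V" for z
  proof -
    have "(\<Sum>b\<in>insert k ?M. A a b z * of_bool (b = k)) =
        (\<Sum>b\<in>insert k ?M. if b = k then A a k z else 0)" for a
      by (rule sum.cong) auto
    then have "(\<Sum>b\<in>insert k ?M. A a b z * of_bool (b = k)) = A a k z" for a
      using fin by simp
    then have "(\<Sum>a\<in>insert k ?M. cnj (of_bool (a = k)) *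
        (\<Sum>b\<in>insert k ?M. A a b z * of_bool (b = k))) =
        (\<Sum>a\<in>insert k ?M. if a = k then A k k z else 0)"
      by (intro sum.cong) auto
    then have "(\<Sum>a\<in>insert k ?M. cnj (of_bool (a = k)) *
        (\<Sum>b\<in>insert k ?M. A a b z * of_bool (b = k))) = A k k z"
      using fin by simp
    then show ?thesis
      using pos[OF that, of k "\<lambda>a. of_bool (a = k)"] by force
  qed
  define B where "B a b z = A a b z - A a k z * A k b z / A k k z" for a b z
  define row where "row a z u = (\<Sum>b\<in>?M. A a b z * u b)" for a z and u :: "'a \<Rightarrow> complex"
  have full: "(\<Sum>b\<in>insert k ?M. A a b z * u b) = A a k z * u k + row a z u" for a z u
    unfolding row_def by (rule sum.insert[OF fin k])
  have Bsum: "(\<Sum>b\<in>?M. B a b z * u b) = row a z u - A a k z * row k z u / A k k z" for a z u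
    unfolding B_def row_def
    by (simp only: left_diff_distrib sum_subtractf sum_distrib_left sum_divide_distrib
        times_divide_eq_left mult.assoc)
  \<comment> \<open>Row \<open>k\<close> gives \<open>u k = - row k z u / A k k z\<close>; inserting
    this produces exactly the correction term of \<open>B\<close>.\<close>
  have eliminated: "(\<Sum>b\<in>insert k ?M. A a b z * u b) = (\<Sum>b\<in>?M. B a b z * u b)"
    if "z \<in> right_half V" "(\<Sum>b\<in>insert k ?M. A k b z * u b) = 0" for a z u
  proof -
    have "row k z u = - (A k k z * u k)"
      using that(2) unfolding full by (simp add: add_eq_0_iff)
    then show ?thesis
      using nz[OF that(1)] unfolding full Bsum by simp
  qed
  have "\<exists>C. homogeneous_ratio V C \<and> (\<forall>z\<in>right_half V. Re (C z) > 0 \<and>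
    (\<forall>u. (\<forall>a\<in>N. (\<Sum>b\<in>?M. B a b z * u b) = 0) \<longrightarrow> (\<Sum>b\<in>?M. B r b z * u b) = C z * u r))"
  proof (rule insert.IH)
    show "r \<notin> N"
      using insert.prems(1) by simp
    show "homogeneous_ratio V (B a b)" if "a \<in> ?M" "b \<in> ?M" for a b
      unfolding B_def by (intro homogeneous_ratio_schur hr nz insertI1 insertI2 that)
    show "Re (\<Sum>a\<in>?M. cnj (u a) * (\<Sum>b\<in>?M. B a b z * u b)) > 0"
      if z: "z \<in> right_half V" and a: "a \<in> ?M" "u a \<noteq> 0" for z u a
    proof -
      \<comment> \<open>Extend \<open>u\<close> to the eliminated node so that the row of that node vanishes.\<close>
      define v where "v = u(k := - row k z u / A k k z)"
      have vu: "v b = u b" if "b \<in> ?M" for b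
        using that k by (auto simp: v_def)
      have row: "row a z v = row a z u" for a
        unfolding row_def by (rule sum.cong) (simp_all add: vu)
      have k0: "(\<Sum>b\<in>insert k ?M. A k b z * v b) = 0"
        using nz[OF z] unfolding full row by (simp add: v_def)
      have "0 < Re (\<Sum>a\<in>insert k ?M. cnj (v a) * (\<Sum>b\<in>insert k ?M. A a b z * v b))"
        by (rule pos[OF z, of a]) (use a vu in auto)
      also have "\<dots> = Re (\<Sum>a\<in>?M. cnj (v a) * (\<Sum>b\<in>insert k ?M. A a b z * v b))"
        by (subst sum.insert[OF fin k]) (simp only: k0 mult_zero_right add_0)
      also have "\<dots> = Re (\<Sum>a\<in>?M. cnj (u a) * (\<Sum>b\<in>?M. B a b z * u b))"
        by (simp only: eliminated[OF z k0] Bsum row vu cong: sum.cong)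
      finally show ?thesis .
    qed
  qed
  then obtain C where C: "homogeneous_ratio V C" "\<And>z. z \<in> right_half V \<Longrightarrow> Re (C z) > 0"
    "\<And>z u. z \<in> right_half V \<Longrightarrow> (\<forall>a\<in>N. (\<Sum>b\<in>?M. B a b z * u b) = 0) \<Longrightarrow>
      (\<Sum>b\<in>?M. B r b z * u b) = C z * u r"
    by blast
  show ?case
    unfolding ins
  proof (intro exI[of _ C] conjI ballI allI impI C)
    fix z u
    assume z: "z \<in> right_half V"
      and u: "\<forall>a\<in>insert k N. (\<Sum>b\<in>insert k ?M. A a b z * u b) = 0"
    then have k0: "(\<Sum>b\<in>insert k ?M. A k b z * u b) = 0"
      by blast
    show "(\<Sum>b\<in>insert k ?M. A r b z * u b) = C z * u r"
      using C(3)[OF z, of u] u unfolding eliminated[OF z k0] by blast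
  qed
qed

section \<open>Widths of tiles along horizontal levels\<close>

text \<open>Compare areas in the strip between heights \<open>s\<close> and \<open>t\<close>. No
  tile starts or ends strictly inside, so each tile meets the strip in its full height or in a null
  set. Dividing the total area by \<open>t - s\<close> leaves the widths.\<close>

lemma division_strip_width:
  fixes xl xr lo hi :: "(real \<times> real) set \<Rightarrow> real"
  assumes div: "\<T> division_of ({x1..x2} \<times> {y1..y2})" and "x1 < x2"
    and T: "\<And>T. T \<in> \<T> \<Longrightarrow> T = {xl T..xr T} \<times> {lo T..hi T}"
    and less: "\<And>T. T \<in> \<T> \<Longrightarrow> xl T < xr T" "\<And>T. T \<in> \<T> \<Longrightarrow> lo T < hi T"
    and st: "y1 \<le> s" "s < t" "t \<le> y2"
    and gap: "\<And>T. T \<in> \<T> \<Longrightarrow> lo T \<notin> {s<..<t}" "\<And>T. T \<in> \<T> \<Longrightarrow> hi T \<notin> {s<..<t}"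
  shows "(\<Sum>T | T \<in> \<T> \<and> lo T \<le> s \<and> t \<le> hi T. xr T - xl T) = x2 - x1"
proof -
  define S where "S = {x1..x2} \<times> {s..t}"
  have box: "{a..b} \<times> {c..d} = cbox (a, c) (b, d)" for a b c d :: real
    by (simp add: cbox_Pair_eq)
  \<comment> \<open>The \<open>max 0\<close> covers tiles that miss the strip, for which the
    vertical interval in \<open>TS\<close> is empty.\<close>
  have area: "measure lebesgue ({a..b} \<times> {c..d}) = (b - a) * max 0 (d - c)"
    if "a < b" for a b c d :: real
    using that unfolding box by (simp add: content_Pair content_real_if max_def)
  have TS: "T \<inter> S = {xl T..xr T} \<times> {max (lo T) s..min (hi T) t}" if "T \<in> \<T>" for T
  proof -
    have "T \<subseteq> {x1..x2} \<times> {y1..y2}"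
      using division_ofD(2)[OF div that] .
    then have "{xl T..xr T} \<times> {lo T..hi T} \<subseteq> {x1..x2} \<times> {y1..y2}"
      using T[OF that] by simp
    then have "x1 \<le> xl T \<and> xr T \<le> x2"
      using less[OF that] by (auto simp: times_subset_iff)
    then show ?thesis
      by (subst T[OF that]) (auto simp: S_def)
  qed
  have "measure lebesgue (\<Union>T\<in>\<T>. T \<inter> S) = (\<Sum>T\<in>\<T>. measure lebesgue (T \<inter> S))"
  proof (rule measure_negligible_finite_Union_image)
    show "finite \<T>"
      using div by blast
    show "T \<inter> S \<in> lmeasurable" if "T \<in> \<T>" for T
      unfolding TS[OF that] box by (rule lmeasurable_cbox)
    show "pairwise (\<lambda>T T'. negligible (T \<inter> S \<inter> (T' \<inter> S))) \<T>"
    proof (rule pairwiseI)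
      fix T T' assume *: "T \<in> \<T>" "T' \<in> \<T>" "T \<noteq> T'"
      then have "interior (T \<inter> T') = {}"
        using division_ofD(5)[OF div] by (simp add: interior_Int)
      moreover have "convex (T \<inter> T')"
        using T * by (metis convex_Int convex_Times convex_real_interval(5))
      ultimately have "negligible (T \<inter> T')"
        by (simp add: negligible_convex_interior)
      then show "negligible (T \<inter> S \<inter> (T' \<inter> S))"
        by (rule negligible_subset) auto
    qed
  qed
  moreover have "(\<Union>T\<in>\<T>. T \<inter> S) = S"
    using division_ofD(6)[OF div] st by (auto simp: S_def)
  moreover have "measure lebesgue S = (x2 - x1) * (t - s)"
    unfolding S_def using area[OF \<open>x1 < x2\<close>] st by simp
  moreover have "measure lebesgue (T \<inter> S) =
      (if lo T \<le> s \<and> t \<le> hi T then (xr T - xl T) * (t - s) else 0)" if "T \<in> \<T>" for T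
    using gap[OF that] less[OF that] st
    unfolding TS[OF that] by (auto simp: area max_def min_def not_less not_le)
  ultimately have "(x2 - x1) * (t - s) =
      (\<Sum>T\<in>\<T>. if lo T \<le> s \<and> t \<le> hi T then (xr T - xl T) * (t - s) else 0)"
    by simp
  also have "\<dots> = (\<Sum>T | T \<in> \<T> \<and> lo T \<le> s \<and> t \<le> hi T. xr T - xl T) * (t - s)"
    using division_of_finite[OF div] 
    by (simp add: sum.inter_filter sum_distrib_right if_distrib[of "\<lambda>x. x * _"] cong: if_cong)
  finally show ?thesis
    using st by simp
qed

text \<open>Yields a strip just below level \<open>y\<close> free of tile ends. Inserting
  \<open>l\<close> keeps the maximum defined and the strip above \<open>l\<close>.\<close>

lemma finite_gap_below:
  fixes y :: real
  assumes "finite E" "l < y"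
  obtains s where "l \<le> s" "s < y" "E \<inter> {s<..<y} = {}"
proof
  let ?s = "Max (insert l {e \<in> E. e < y})"
  show "l \<le> ?s" "?s < y"
    using assms by auto
  have "e \<le> ?s" if "e \<in> E" "e < y" for e
    using that assms by (intro Max_ge) auto
  then show "E \<inter> {?s<..<y} = {}"
    by fastforce
qed

lemma finite_gap_above:
  fixes y :: real
  assumes "finite E" "y < h"
  obtains t where "t \<le> h" "y < t" "E \<inter> {y<..<t} = {}"
proof
  let ?t = "Min (insert h {e \<in> E. y < e})"
  show "?t \<le> h" "y < ?t"
    using assms by auto
  have "?t \<le> e" if "e \<in> E" "y < e" for e
    using that assms by (intro Min_le) auto
  then show "E \<inter> {y<..<?t} = {}"
    by fastforce
qed

text \<open>Kirchhoff's law. Thin strips just below and just above \<open>y\<close> both have total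
  width \<open>x2 - x1\<close>; tiles crossing \<open>y\<close> occur in both and cancel. At
  \<open>y2\<close>, the tiles of the strip below are exactly those ending there.\<close>

lemma division_widths_at_level:
  fixes xl xr lo hi :: "(real \<times> real) set \<Rightarrow> real"
  assumes div: "\<T> division_of ({x1..x2} \<times> {y1..y2})" and "x1 < x2" "y1 < y2"
    and T: "\<And>T. T \<in> \<T> \<Longrightarrow> T = {xl T..xr T} \<times> {lo T..hi T}"
    and less: "\<And>T. T \<in> \<T> \<Longrightarrow> xl T < xr T" "\<And>T. T \<in> \<T> \<Longrightarrow> lo T < hi T"
  shows "y1 < y \<Longrightarrow> y < y2 \<Longrightarrow>
      (\<Sum>T | T \<in> \<T> \<and> lo T = y. xr T - xl T) = (\<Sum>T | T \<in> \<T> \<and> hi T = y. xr T - xl T)"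
    and "(\<Sum>T | T \<in> \<T> \<and> hi T = y2. xr T - xl T) = x2 - x1"
proof -
  have fin: "finite \<T>"
    using div by blast
  let ?w = "\<lambda>T. xr T - xl T"
  have below: "(\<Sum>T | T \<in> \<T> \<and> lo T < y \<and> y \<le> hi T. ?w T) = x2 - x1" if y: "y1 < y" "y \<le> y2" for y
  proof -
    obtain s where s: "y1 \<le> s" "s < y" "(lo ` \<T> \<union> hi ` \<T>) \<inter> {s<..<y} = {}"
      using finite_gap_below[of "lo ` \<T> \<union> hi ` \<T>" y1 y] fin y by blast
    then have "{T \<in> \<T>. lo T < y \<and> y \<le> hi T} = {T \<in> \<T>. lo T \<le> s \<and> y \<le> hi T}"
      by force
    then show ?thesis
      using division_strip_width[OF div \<open>x1 < x2\<close> T less s(1,2) y(2)] s(3) by force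
  qed
  have above: "(\<Sum>T | T \<in> \<T> \<and> lo T \<le> y \<and> y < hi T. ?w T) = x2 - x1" if y: "y1 \<le> y" "y < y2" for y
  proof -
    obtain t where t: "t \<le> y2" "y < t" "(lo ` \<T> \<union> hi ` \<T>) \<inter> {y<..<t} = {}"
      using finite_gap_above[of "lo ` \<T> \<union> hi ` \<T>" y y2] fin y by blast
    then have "{T \<in> \<T>. lo T \<le> y \<and> y < hi T} = {T \<in> \<T>. lo T \<le> y \<and> t \<le> hi T}"
      by force
    then show ?thesis
      using division_strip_width[OF div \<open>x1 < x2\<close> T less y(1) t(2,1)] t(3) by force
  qed
  show "(\<Sum>T | T \<in> \<T> \<and> lo T = y. ?w T) = (\<Sum>T | T \<in> \<T> \<and> hi T = y. ?w T)"
    if y: "y1 < y" "y < y2"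
  proof -
    let ?I = "{T \<in> \<T>. lo T < y \<and> y < hi T}"
    have "sum ?w {T \<in> \<T>. lo T \<le> y \<and> y < hi T} = sum ?w (?I \<union> {T \<in> \<T>. lo T = y})"
      using less(2) by (intro sum.cong) auto
    moreover have "\<dots> = sum ?w ?I + sum ?w {T \<in> \<T>. lo T = y}"
      using fin by (intro sum.union_disjoint) auto
    moreover have "sum ?w {T \<in> \<T>. lo T < y \<and> y \<le> hi T} = sum ?w (?I \<union> {T \<in> \<T>. hi T = y})"
      using less(2) by (intro sum.cong) auto
    moreover have "\<dots> = sum ?w ?I + sum ?w {T \<in> \<T>. hi T = y}"
      using fin by (intro sum.union_disjoint) auto
    ultimately show ?thesis
      using below[of y] above[of y] y by simp
  qed
  have "hi T \<le> y2" if "T \<in> \<T>" for T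
  proof -
    have "(xl T, hi T) \<in> T"
      by (subst T[OF that]) (use less[OF that] in auto)
    then show ?thesis
      using division_ofD(2)[OF div that] by auto
  qed
  then have "{T \<in> \<T>. hi T = y2} = {T \<in> \<T>. lo T < y2 \<and> y2 \<le> hi T}"
    using less(2) by force
  then show "(\<Sum>T | T \<in> \<T> \<and> hi T = y2. ?w T) = x2 - x1"
    using below[of y2] \<open>y1 < y2\<close> by simp
qed

section \<open>The grounded Laplacian of a network\<close>

text \<open>Nodes outside \<open>N\<close> are grounded and \<open>W\<close> is the current entering
  at \<open>r\<close>. With \<open>inc\<close> as signed incidence, the form of the Laplacian is the
  sum of \<open>z (idx j)\<close> times the squared modulus of the drop along edge \<open>j\<close>.
  It has positive real part because every node of \<open>N\<close> is the upper end of an edge,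
  which excludes a nonzero potential without drops.\<close>

lemma effective_conductance:
  fixes lo hi :: "'j \<Rightarrow> 'a::linorder" and idx :: "'j \<Rightarrow> nat"
  defines "inc \<equiv> \<lambda>j a. of_bool (a = hi j) - of_bool (a = lo j) :: int"
  assumes "finite J" and N: "N = hi ` J" and "r \<in> N"
    and idx: "\<And>j. j \<in> J \<Longrightarrow> idx j \<in> V" and less: "\<And>j. j \<in> J \<Longrightarrow> lo j < hi j"
  shows "\<exists>C. homogeneous_ratio V C \<and> (\<forall>z\<in>right_half V. Re (C z) > 0 \<and>
    (\<forall>u W. (\<forall>a. a \<notin> N \<longrightarrow> u a = 0) \<longrightarrow>
      (\<forall>a\<in>N. (\<Sum>j\<in>J. of_int (inc j a) * z (idx j) * (u (hi j) - u (lo j))) =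
        (if a = r then W else 0)) \<longrightarrow> W = C z * u r))"
proof -
  define A where "A a b z = (\<Sum>j\<in>J. of_int (inc j a * inc j b) * z (idx j))"
    for a b and z :: "nat \<Rightarrow> complex"
  have fin: "finite N" and N': "insert r (N - {r}) = N"
    using N \<open>finite J\<close> \<open>r \<in> N\<close> by auto
  \<comment> \<open>An end outside \<open>N\<close> contributes nothing to the sum, which matches
    its grounded potential in the extension \<open>v\<close> of \<open>u\<close> by zero.\<close>
  have drop: "(\<Sum>b\<in>N. of_int (inc j b) * u b) = v (hi j) - v (lo j)"
    if "\<And>a. v a = (if a \<in> N then u a else 0)" for u v :: "'a \<Rightarrow> complex" and j
  proof -
    have "(\<Sum>b\<in>N. of_int (inc j b) * u b) =
        (\<Sum>b\<in>N. if b = hi j then u b else 0) - (\<Sum>b\<in>N. if b = lo j then u b else 0)"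
      unfolding sum_subtractf[symmetric] by (rule sum.cong) (auto simp: inc_def)
    then show ?thesis
      using fin by (simp add: that)
  qed
  have row: "(\<Sum>b\<in>N. A a b z * u b) =
      (\<Sum>j\<in>J. of_int (inc j a) * z (idx j) * (\<Sum>b\<in>N. of_int (inc j b) * u b))" for a z u
    unfolding A_def sum_distrib_left sum_distrib_right
    by (subst sum.swap) (simp add: mult_ac)
  have form: "(\<Sum>a\<in>N. cnj (u a) * (\<Sum>b\<in>N. A a b z * u b)) =
      (\<Sum>j\<in>J. z (idx j) * of_real ((norm (\<Sum>b\<in>N. of_int (inc j b) * u b))\<^sup>2))" for z u
  proof -
    define e where "e j = (\<Sum>b\<in>N. of_int (inc j b) * u b)" for j
    have cnj_e: "cnj (e j) = (\<Sum>a\<in>N. of_int (inc j a) * cnj (u a))" for j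
      by (simp add: e_def)
    have "(\<Sum>a\<in>N. cnj (u a) * (\<Sum>b\<in>N. A a b z * u b)) =
        (\<Sum>j\<in>J. \<Sum>a\<in>N. cnj (u a) * (of_int (inc j a) * z (idx j) * e j))"
      unfolding row e_def[symmetric] sum_distrib_left by (rule sum.swap)
    also have "\<dots> = (\<Sum>j\<in>J. z (idx j) * (e j * cnj (e j)))"
      unfolding cnj_e by (simp add: sum_distrib_left mult_ac)
    finally show ?thesis
      by (simp only: complex_norm_square e_def)
  qed
  have "\<exists>C. homogeneous_ratio V C \<and> (\<forall>z\<in>right_half V. Re (C z) > 0 \<and>
    (\<forall>u. (\<forall>a\<in>N - {r}. (\<Sum>b\<in>insert r (N - {r}). A a b z * u b) = 0) \<longrightarrow>
      (\<Sum>b\<in>insert r (N - {r}). A r b z * u b) = C z * u r))"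
  proof (rule schur_elimination)
    show "finite (N - {r})" "r \<notin> N - {r}"
      using fin by auto
    show "homogeneous_ratio V (A a b)" for a b
      unfolding A_def by (rule homogeneous_ratio_linear) (rule idx)
    show "Re (\<Sum>a\<in>insert r (N - {r}). cnj (u a) * (\<Sum>b\<in>insert r (N - {r}). A a b z * u b)) > 0"
      if z: "z \<in> right_half V" and a: "a \<in> insert r (N - {r})" "u a \<noteq> 0" for z u a
    proof -
      define v where "v a = (if a \<in> N then u a else 0)" for a
      let ?S = "{a \<in> N. v a \<noteq> 0}"
      \<comment> \<open>An edge descending from the lowest node of nonzero potential carries a nonzero drop.\<close>
      have S: "finite ?S" "?S \<noteq> {}"
        using fin a \<open>r \<in> N\<close> by (auto simp: v_def)
      have "Min ?S \<in> ?S"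
        using Min_in[OF S] .
      then obtain j where j: "j \<in> J" "hi j = Min ?S" "v (hi j) \<noteq> 0"
        using N by auto
      have "\<not> Min ?S \<le> lo j"
        using less[OF j(1)] j(2) by simp
      then have "lo j \<notin> ?S"
        using Min_le[OF S(1)] by blast
      then have "v (lo j) = 0"
        by (auto simp: v_def)
      then have "v (hi j) - v (lo j) \<noteq> 0"
        using j by simp
      moreover have pos: "Re (z (idx i)) > 0" if "i \<in> J" for i
        using z idx[OF that] by (simp add: right_half_def)
      ultimately have "(\<Sum>j\<in>J. Re (z (idx j)) * (norm (v (hi j) - v (lo j)))\<^sup>2) > 0"
        using \<open>finite J\<close> j(1) by (intro sum_pos2[of _ j]) (auto simp: less_imp_le)
      then show ?thesis
        unfolding N' form drop[OF v_def] by (simp del: of_real_power)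
    qed
  qed
  then obtain C where C: "homogeneous_ratio V C" "\<And>z. z \<in> right_half V \<Longrightarrow> Re (C z) > 0"
    "\<And>z u. z \<in> right_half V \<Longrightarrow> (\<forall>a\<in>N - {r}. (\<Sum>b\<in>N. A a b z * u b) = 0) \<Longrightarrow>
      (\<Sum>b\<in>N. A r b z * u b) = C z * u r"
    unfolding N' by blast
  show ?thesis
  proof (intro exI[of _ C] conjI ballI allI impI C)
    fix z u W
    assume z: "z \<in> right_half V" and u: "\<forall>a. a \<notin> N \<longrightarrow> u a = 0"
      and W: "\<forall>a\<in>N. (\<Sum>j\<in>J. of_int (inc j a) * z (idx j) * (u (hi j) - u (lo j))) =
        (if a = r then W else 0)"
    have "u a = (if a \<in> N then u a else 0)" for a
      using u by simp
    then have W': "(\<Sum>b\<in>N. A a b z * u b) = (if a = r then W else 0)" if "a \<in> N" for a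
      using W that by (simp only: row drop)
    show "W = C z * u r"
      using C(3)[OF z, of u] W' \<open>r \<in> N\<close> by simp
  qed
qed

section \<open>The network of a tiling\<close>

theorem theorem2:
  fixes n :: nat and c :: real and cs :: "nat \<Rightarrow> real"
    and R :: "(real \<times> real) set" and \<T> :: "(real \<times> real) set set"
  assumes "c > 0" and "\<And>i. i \<in> {1..n} \<Longrightarrow> cs i > 0"
    and "rectangle_of_ratio c R"
    and "\<T> division_of R"
    and "\<And>T. T \<in> \<T> \<Longrightarrow> \<exists>i \<in> {1..n}. rectangle_of_ratio (cs i) T"
  shows "\<exists>C \<in> rat_fun_in {1..n}.
    rat_fun_defined_at C cs \<and> c = rat_fun_eval C cs \<and>
    (\<forall>(t::complex) (z :: nat \<Rightarrow> complex).
       rat_fun_defined_at C z \<and> rat_fun_defined_at C (\<lambda>i. t * z i) \<longrightarrow>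
       rat_fun_eval C (\<lambda>i. t * z i) = t * rat_fun_eval C z) \<and>
    (\<forall>z :: nat \<Rightarrow> complex. (\<forall>i \<in> {1..n}. Re (z i) > 0) \<longrightarrow>
       rat_fun_defined_at C z \<and> Re (rat_fun_eval C z) > 0)"
proof -
  obtain x1 x2 y1 y2 where x: "x1 < x2" and y: "y1 < y2" and R: "R = {x1..x2} \<times> {y1..y2}"
    and c: "c = (x2 - x1) / (y2 - y1)"
    using assms(3) unfolding rectangle_of_ratio_def by blast
  have "\<forall>T\<in>\<T>. \<exists>a b l h i. T = {a..b} \<times> {l..h} \<and> a < b \<and> l < h \<and> i \<in> {1..n} \<and> cs i = (b - a) / (h - l)"
    using assms(5) unfolding rectangle_of_ratio_def by blast
  then obtain xl xr lo hi idx where tile: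
    "\<forall>T\<in>\<T>. T = {xl T..xr T} \<times> {lo T..hi T} \<and> xl T < xr T \<and> lo T < hi T \<and>
      idx T \<in> {1..n} \<and> cs (idx T) = (xr T - xl T) / (hi T - lo T)"
    unfolding bchoice_iff by blast
  note T = bspec[OF tile, THEN conjunct1]
    and less = bspec[OF tile, THEN conjunct2, THEN conjunct1]
      bspec[OF tile, THEN conjunct2, THEN conjunct2, THEN conjunct1]
    and idx = bspec[OF tile, THEN conjunct2, THEN conjunct2, THEN conjunct2, THEN conjunct1]
    and cs_idx = bspec[OF tile, THEN conjunct2, THEN conjunct2, THEN conjunct2, THEN conjunct2]
  \<comment> \<open>Ohm's law for a tile: conductance times potential drop is current.\<close>
  have ratio: "cs (idx T) * (hi T - lo T) = xr T - xl T" if "T \<in> \<T>" for T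
    using less(2)[OF that] by (simp add: cs_idx[OF that])
  note div = assms(4)[unfolded R]
  have fin: "finite \<T>"
    using div by blast
  have interior_level: "(\<Sum>T | T \<in> \<T> \<and> lo T = a. xr T - xl T) =
      (\<Sum>T | T \<in> \<T> \<and> hi T = a. xr T - xl T)" if "y1 < a" "a < y2" for a
    by (rule division_widths_at_level(1)[OF div x y _ _ _ that]) (fact T less)+
  have top_level: "(\<Sum>T | T \<in> \<T> \<and> hi T = y2. xr T - xl T) = x2 - x1"
    by (rule division_widths_at_level(2)[OF div x y]) (fact T less)+
  \<comment> \<open>These are all the ungrounded nodes: \<open>lo_N\<close> will show that the only
    other height at which a tile starts is \<open>y1\<close>.\<close>
  define N where "N = hi ` \<T>"
  have bounds: "y1 \<le> lo T" "hi T \<le> y2" if "T \<in> \<T>" for T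
  proof -
    have "(xl T, lo T) \<in> T" "(xl T, hi T) \<in> T"
      using less[OF that] by (auto intro!: subsetD[OF equalityD2[OF T[OF that]]])
    then show "y1 \<le> lo T" "hi T \<le> y2"
      using division_ofD(2)[OF div that] by auto
  qed
  have "y2 \<in> N"
  proof (rule ccontr)
    assume "y2 \<notin> N"
    then have "{T \<in> \<T>. hi T = y2} = {}"
      by (auto simp: N_def)
    then show False
      using top_level x by (simp only: sum.empty)
  qed
  \<comment> \<open>Tiles starting at an interior level have positive total width there, so by
    \<open>interior_level\<close> some tile also ends at that level.\<close>
  have lo_N: "lo T = y1" if "T \<in> \<T>" "lo T \<notin> N" for T
  proof (rule ccontr)
    assume "lo T \<noteq> y1"
    then have "y1 < lo T" "lo T < y2"
      using bounds[OF that(1)] less[OF that(1)] by auto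
    note interior_level[OF this]
    moreover have none: "{T' \<in> \<T>. hi T' = lo T} = {}"
      using that(2) by (force simp: N_def)
    moreover have "(\<Sum>T' | T' \<in> \<T> \<and> lo T' = lo T. xr T' - xl T') > 0"
      using fin that less by (intro sum_pos) auto
    ultimately show False
      by (simp only: none sum.empty)
  qed
  obtain C where C: "homogeneous_ratio {1..n} C"
    and pos: "\<And>z. z \<in> right_half {1..n} \<Longrightarrow> Re (C z) > 0"
    and kirchhoff: "\<And>z u W. z \<in> right_half {1..n} \<Longrightarrow> \<forall>a. a \<notin> N \<longrightarrow> u a = 0 \<Longrightarrow>
      \<forall>a\<in>N. (\<Sum>T\<in>\<T>. of_int (of_bool (a = hi T) - of_bool (a = lo T)) * z (idx T) *
        (u (hi T) - u (lo T))) = (if a = y2 then W else 0) \<Longrightarrow> W = C z * u y2"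
    using effective_conductance[OF fin N_def \<open>y2 \<in> N\<close>, of idx "{1..n}" lo] idx less(2) by blast
  define zc where "zc i = complex_of_real (cs i)" for i
  have zc: "zc \<in> right_half {1..n}"
    using assms(2) by (simp add: right_half_def zc_def)
  \<comment> \<open>The potential is the height above the bottom, cut off to \<open>0\<close>
    outside \<open>N\<close> as \<open>kirchhoff\<close> demands. By \<open>lo_N\<close> the cut-off
    does not change it at any end of a tile.\<close>
  define u where "u a = complex_of_real (if a \<in> N then a - y1 else 0)" for a
  have current: "zc (idx T) * (u (hi T) - u (lo T)) = of_real (xr T - xl T)" if "T \<in> \<T>" for T
  proof -
    have "u (hi T) = of_real (hi T - y1)" "u (lo T) = of_real (lo T - y1)"
      using that lo_N[OF that] by (auto simp: u_def N_def)
    then show ?thesis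
      unfolding ratio[OF that, symmetric] zc_def by simp
  qed
  \<comment> \<open>The current entering at the top is the width of the big rectangle; inner nodes
    balance by \<open>interior_level\<close>, and no tile starts at \<open>y2\<close>.\<close>
  have "of_real (x2 - x1) = C zc * u y2"
  proof (rule kirchhoff[OF zc]; intro allI ballI impI)
    fix a assume "a \<in> N"
    have "(\<Sum>T\<in>\<T>. of_int (of_bool (a = hi T) - of_bool (a = lo T)) * zc (idx T) *
        (u (hi T) - u (lo T))) =
      (\<Sum>T\<in>\<T>. complex_of_real ((if hi T = a then xr T - xl T else 0) -
        (if lo T = a then xr T - xl T else 0)))"
      by (rule sum.cong) (auto simp: mult.assoc current)
    also have "\<dots> = of_real ((\<Sum>T | T \<in> \<T> \<and> hi T = a. xr T - xl T) -
        (\<Sum>T | T \<in> \<T> \<and> lo T = a. xr T - xl T))"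
      unfolding sum.inter_filter[OF fin] by (simp only: of_real_sum sum_subtractf of_real_diff)
    also have "\<dots> = (if a = y2 then of_real (x2 - x1) else 0)"
    proof (cases "a = y2")
      case True
      have "{T \<in> \<T>. lo T = y2} = {}"
        using bounds less by force
      with True show ?thesis
        by (simp only: top_level sum.empty diff_zero if_True refl)
    next
      case False
      then have "y1 < a" "a < y2"
        using \<open>a \<in> N\<close> bounds less(2) by (force simp: N_def)+
      from interior_level[OF this] False show ?thesis
        by simp
    qed
    finally show "(\<Sum>T\<in>\<T>. of_int (of_bool (a = hi T) - of_bool (a = lo T)) * zc (idx T) *
        (u (hi T) - u (lo T))) = (if a = y2 then of_real (x2 - x1) else 0)" .
  qed (simp add: u_def)
  then have "of_real (x2 - x1) = C zc * of_real (y2 - y1)"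
    using \<open>y2 \<in> N\<close> by (simp add: u_def)
  then have C_zc: "C zc = of_real c"
    using y by (simp add: c field_simps)
  obtain p q k where pq: "p \<in> mpoly_in {1..n}" "q \<in> mpoly_in {1..n}"
    and hom: "homogeneous (Suc k) p" "homogeneous k q"
    and ev: "\<And>z. z \<in> right_half {1..n} \<Longrightarrow>
      mpoly_eval q z \<noteq> 0 \<and> C z = mpoly_eval p z / mpoly_eval q z"
    using C unfolding homogeneous_ratio_def by blast
  have "q \<noteq> 0"
    using ev[OF zc] by auto
  \<comment> \<open>\<open>C\<close> was obtained over the complex numbers; evaluation commutes with
    the embedding of the reals, so its values pass to the real point \<open>cs\<close>.\<close>
  have q_cs: "mpoly_eval q cs \<noteq> 0"
    using ev[OF zc] by (auto simp: zc_def[abs_def] mpoly_eval_of_real)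
  have "complex_of_real c = of_real (mpoly_eval p cs / mpoly_eval q cs)"
    using ev[OF zc] C_zc by (simp add: zc_def[abs_def] mpoly_eval_of_real)
  then have c_eq: "c = mpoly_eval p cs / mpoly_eval q cs"
    by (simp only: of_real_eq_iff)
  \<comment> \<open>In the right half-space \<open>q\<close> itself witnesses definedness. Only the
    scaling claim concerns other points, where \<open>q\<close> may vanish and
    \<open>rat_fun_eval_scale\<close> is needed.\<close>
  show ?thesis
  proof (intro bexI[of _ "Fract p q"] conjI allI impI)
    show "Fract p q \<in> rat_fun_in {1..n}"
      using pq \<open>q \<noteq> 0\<close> unfolding rat_fun_in_def by blast
    show "rat_fun_defined_at (Fract p q) cs"
      using q_cs unfolding rat_fun_defined_at_def by blast
    show "c = rat_fun_eval (Fract p q) cs"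
      unfolding rat_fun_eval_Fract[OF q_cs] by (rule c_eq)
    show "rat_fun_eval (Fract p q) (\<lambda>i. t * z i) = t * rat_fun_eval (Fract p q) z"
      if "rat_fun_defined_at (Fract p q) z \<and> rat_fun_defined_at (Fract p q) (\<lambda>i. t * z i)"
      for t and z :: "nat \<Rightarrow> complex"
      by (rule rat_fun_eval_scale[OF hom]) (use that ev in auto)
    show "rat_fun_defined_at (Fract p q) z" "Re (rat_fun_eval (Fract p q) z) > 0"
      if "\<forall>i\<in>{1..n}. Re (z i) > 0" for z :: "nat \<Rightarrow> complex"
    proof -
      have z: "z \<in> right_half {1..n}"
        using that by (simp add: right_half_def)
      then have q: "mpoly_eval q z \<noteq> 0"
        using ev by blast
      then show "rat_fun_defined_at (Fract p q) z"
        unfolding rat_fun_defined_at_def by blast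
      show "Re (rat_fun_eval (Fract p q) z) > 0"
        using pos[OF z] ev[OF z] unfolding rat_fun_eval_Fract[OF q] by simp
    qed
  qed
qed

end
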